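(* Let $A$ be a vector space over a field $\mathbb{K}$ of characteristic zero and let $\alpha,\beta:A\to A$ be two commuting linear maps. For $k\ge1$ let $C^k_{\alpha,\beta}(A,A)$ be the space of linear maps $f:A^{\otimes k}\to A$ with $\alpha\circ f=f\circ\alpha^{\otimes k}$ and $\beta\circ f=f\circ\beta^{\otimes k}$. For $f\in C^m_{\alpha,\beta}(A,A)$, $g\in C^n_{\alpha,\beta}(A,A)$ and $1\le i\le m$ define $$(f\circ_i g)(a_1,\dots,a_{m+n-1})=f\big(\alpha^{n-1}a_1,\dots,\alpha^{n-1}a_{i-1},\,g(a_i,\dots,a_{i+n-1}),\,\beta^{n-1}a_{i+n},\dots,\beta^{n-1}a_{m+n-1}\big).$$ Then the partial compositions $\circ_i$ define a non-symmetric operad structure on $\{C^k_{\alpha,\beta}(A,A)\}_{k\ge1}$ with identity element the identity map $\mathrm{id}\in C^1_{\alpha,\beta}(A,A)$.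
   Context: A non-symmetric operad in vector spaces (described by partial compositions) is a collection of vector spaces $\{\mathcal{O}(k)\mid k\ge1\}$ with linear maps $\circ_i:\mathcal{O}(m)\otimes\mathcal{O}(n)\to\mathcal{O}(m+n-1)$, $1\le i\le m$, and an element $\mathrm{id}\in\mathcal{O}(1)$ such that for all $f\in\mathcal{O}(m)$, $g\in\mathcal{O}(n)$, $h\in\mathcal{O}(p)$: (1) $(f\circ_i g)\circ_{i+j-1}h=f\circ_i(g\circ_j h)$ for $1\le i\le m$, $1\le j\le n$; (2) $(f\circ_i g)\circ_{j+n-1}h=(f\circ_j h)\circ_i g$ for $1\le i<j\le m$; (3) $f\circ_i\mathrm{id}=f=\mathrm{id}\circ_1 f$ for $1\le i\le m$. *)

theory Defs
  imports Complex_Main "HOL-Library.Function_Algebras"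
begin

text \<open>
  The component vector spaces \<open>Op k\<close>, \<open>k \<ge> 1\<close>, are given as subspaces of one ambient vector space
  (any family of vector spaces embeds in its direct sum). They need not intersect trivially, so the
  partial composition carries the arities: \<open>pcomp m n i f g\<close> is \<open>f \<circ>\<^sub>i g\<close> for \<open>f \<in> Op m\<close>, \<open>g \<in> Op n\<close>.
  A linear map \<open>Op m \<otimes> Op n \<rightarrow> Op (m + n - 1)\<close> is rendered as a bilinear map on
  \<open>Op m \<times> Op n\<close>. Values of \<open>Op\<close> and \<open>pcomp\<close> outside the stated ranges are irrelevant.
\<close>

locale ns_operad = vector_space scale
  for scale :: "'k::field \<Rightarrow> 'o::ab_group_add \<Rightarrow> 'o" +
  fixes Op :: "nat \<Rightarrow> 'o set"
    and pcomp :: "nat \<Rightarrow> nat \<Rightarrow> nat \<Rightarrow> 'o \<Rightarrow> 'o \<Rightarrow> 'o"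
    and ident :: 'o
  assumes subspace_Op: "k \<ge> 1 \<Longrightarrow> subspace (Op k)"
    and pcomp_closed:
      "\<lbrakk>n \<ge> 1; 1 \<le> i; i \<le> m; f \<in> Op m; g \<in> Op n\<rbrakk> \<Longrightarrow> pcomp m n i f g \<in> Op (m + n - 1)"
    and pcomp_add_left:
      "\<lbrakk>n \<ge> 1; 1 \<le> i; i \<le> m; f \<in> Op m; f' \<in> Op m; g \<in> Op n\<rbrakk>
        \<Longrightarrow> pcomp m n i (f + f') g = pcomp m n i f g + pcomp m n i f' g"
    and pcomp_add_right:
      "\<lbrakk>n \<ge> 1; 1 \<le> i; i \<le> m; f \<in> Op m; g \<in> Op n; g' \<in> Op n\<rbrakk>
        \<Longrightarrow> pcomp m n i f (g + g') = pcomp m n i f g + pcomp m n i f g'"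
    and pcomp_scale_left:
      "\<lbrakk>n \<ge> 1; 1 \<le> i; i \<le> m; f \<in> Op m; g \<in> Op n\<rbrakk>
        \<Longrightarrow> pcomp m n i (scale c f) g = scale c (pcomp m n i f g)"
    and pcomp_scale_right:
      "\<lbrakk>n \<ge> 1; 1 \<le> i; i \<le> m; f \<in> Op m; g \<in> Op n\<rbrakk>
        \<Longrightarrow> pcomp m n i f (scale c g) = scale c (pcomp m n i f g)"
    and ident_closed: "ident \<in> Op 1"
    and sequential_assoc:
      "\<lbrakk>p \<ge> 1; 1 \<le> i; i \<le> m; 1 \<le> j; j \<le> n; f \<in> Op m; g \<in> Op n; h \<in> Op p\<rbrakk>
        \<Longrightarrow> pcomp (m + n - 1) p (i + j - 1) (pcomp m n i f g) h
          = pcomp m (n + p - 1) i f (pcomp n p j g h)"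
    and parallel_assoc:
      "\<lbrakk>n \<ge> 1; p \<ge> 1; 1 \<le> i; i < j; j \<le> m; f \<in> Op m; g \<in> Op n; h \<in> Op p\<rbrakk>
        \<Longrightarrow> pcomp (m + n - 1) p (j + n - 1) (pcomp m n i f g) h
          = pcomp (m + p - 1) n i (pcomp m p j f h) g"
    and ident_right: "\<lbrakk>1 \<le> i; i \<le> m; f \<in> Op m\<rbrakk> \<Longrightarrow> pcomp m 1 i f ident = f"
    and ident_left: "\<lbrakk>m \<ge> 1; f \<in> Op m\<rbrakk> \<Longrightarrow> pcomp 1 m 1 ident f = f"

text \<open>
  A linear map \<open>A\<^sup>\<otimes>\<^sup>k \<rightarrow> A\<close> is represented by the corresponding \<open>k\<close>-linear map
  \<open>(a\<^sub>1, \<dots>, a\<^sub>k) \<mapsto> f (a\<^sub>1 \<otimes> \<dots> \<otimes> a\<^sub>k)\<close> on lists of length \<open>k\<close>. It is extended by \<open>0\<close> to lists of any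
  other length, so that the representation is unique and compatible with the pointwise vector space
  structure on \<open>'a list \<Rightarrow> 'a\<close>.
\<close>

definition multilinear_map ::
  "('k::field \<Rightarrow> 'a::ab_group_add \<Rightarrow> 'a) \<Rightarrow> nat \<Rightarrow> ('a list \<Rightarrow> 'a) \<Rightarrow> bool" where
  "multilinear_map scale k f \<longleftrightarrow>
     (\<forall>xs i. length xs = k \<longrightarrow> i < k \<longrightarrow> Vector_Spaces.linear scale scale (\<lambda>a. f (xs[i := a]))) \<and>
     (\<forall>xs. length xs \<noteq> k \<longrightarrow> f xs = 0)"

definition pointwise_scale ::
  "('k \<Rightarrow> 'a \<Rightarrow> 'a) \<Rightarrow> 'k \<Rightarrow> ('a list \<Rightarrow> 'a) \<Rightarrow> 'a list \<Rightarrow> 'a" where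
  "pointwise_scale scale c f = (\<lambda>xs. scale c (f xs))"

text \<open>Under this representation \<open>f \<circ> \<alpha>\<^sup>\<otimes>\<^sup>k\<close> is \<open>f \<circ> map \<alpha>\<close>.\<close>

definition cochains ::
  "('k::field \<Rightarrow> 'a::ab_group_add \<Rightarrow> 'a) \<Rightarrow> ('a \<Rightarrow> 'a) \<Rightarrow> ('a \<Rightarrow> 'a) \<Rightarrow> nat
    \<Rightarrow> ('a list \<Rightarrow> 'a) set" where
  "cochains scale \<alpha> \<beta> k =
     {f. multilinear_map scale k f \<and> \<alpha> \<circ> f = f \<circ> map \<alpha> \<and> \<beta> \<circ> f = f \<circ> map \<beta>}"

text \<open>The slot \<open>i\<close> is counted from 1, list positions from 0.\<close>

definition partial_comp ::
  "('a::zero \<Rightarrow> 'a) \<Rightarrow> ('a \<Rightarrow> 'a) \<Rightarrow> nat \<Rightarrow> nat \<Rightarrow> nat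
    \<Rightarrow> ('a list \<Rightarrow> 'a) \<Rightarrow> ('a list \<Rightarrow> 'a) \<Rightarrow> 'a list \<Rightarrow> 'a" where
  "partial_comp \<alpha> \<beta> m n i f g = (\<lambda>xs.
     if length xs = m + n - 1 then
       f (map (\<alpha> ^^ (n - 1)) (take (i - 1) xs)
          @ [g (take n (drop (i - 1) xs))]
          @ map (\<beta> ^^ (n - 1)) (drop (i - 1 + n) xs))
     else 0)"

definition identity_cochain :: "'a::zero list \<Rightarrow> 'a" where
  "identity_cochain xs = (if length xs = 1 then hd xs else 0)"

end

theory Submission
  imports Defs
begin

text \<open>
  Everything reduces to cutting the argument list into consecutive blocks. If \<open>us\<close> fills the slots
  before the \<open>i\<close>-th one of \<open>f\<close> and \<open>ys\<close> the slots of \<open>g\<close>, then \<open>f \<circ>\<^sub>i g\<close> sends \<open>us @ ys @ vs\<close> to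
  \<open>f (\<alpha>\<^sup>n\<^sup>-\<^sup>1 us, g ys, \<beta>\<^sup>n\<^sup>-\<^sup>1 vs)\<close> (\<open>partial_comp_append\<close>), with the maps applied entrywise.

  For the sequential axiom the list splits into five blocks \<open>us, as, hs, bs, vs\<close>, where \<open>hs\<close> goes into
  \<open>h\<close> and \<open>as, bs\<close> are the other arguments of \<open>g\<close>. The two sides differ only in that \<open>us\<close> meets
  \<open>\<alpha>\<^sup>n\<^sup>-\<^sup>1 \<alpha>\<^sup>p\<^sup>-\<^sup>1\<close> in one and \<open>\<alpha>\<^sup>n\<^sup>+\<^sup>p\<^sup>-\<^sup>2\<close> in the other, and similarly \<open>vs\<close> with \<open>\<beta>\<close>: the twisting exponent
  \<open>arity - 1\<close> is additive under partial composition (\<open>partial_comp_sequential\<close>).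

  For the parallel axiom the blocks are \<open>us, ys, cs, zs, vs\<close>, with \<open>ys\<close> going into \<open>g\<close> and \<open>zs\<close> into
  \<open>h\<close>. Here \<open>g\<close> is twisted by \<open>\<alpha>\<^sup>p\<^sup>-\<^sup>1\<close>, since it stands to the left of \<open>h\<close>, and \<open>h\<close> by \<open>\<beta>\<^sup>n\<^sup>-\<^sup>1\<close>.
  A twist is applied to the arguments on one side of the axiom and to the value on the other, which
  is the same for cochains; the middle block \<open>cs\<close> is twisted by both, so that \<open>\<alpha>\<close> and \<open>\<beta>\<close> must commute
  (\<open>partial_comp_parallel\<close>).

  Commutation of \<open>\<alpha>\<close> and \<open>\<beta>\<close> also makes the composite of two cochains a cochain
  (\<open>partial_comp_intertwines\<close>). It is multilinear because the map into each slot of \<open>f \<circ>\<^sub>i g\<close> is a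
  composite of two linear maps (\<open>multilinear_map_partial_comp\<close>).
\<close>

section \<open>Powers of commuting and of linear maps\<close>

lemma funpow_commute_apply:
  assumes "\<phi> \<circ> \<psi> = \<psi> \<circ> \<phi>"
  shows "\<phi> ((\<psi> ^^ k) a) = (\<psi> ^^ k) (\<phi> a)"
  using assms by (induction k) (auto simp: fun_eq_iff)

lemma funpow_funpow_commute_apply:
  assumes "\<phi> \<circ> \<psi> = \<psi> \<circ> \<phi>"
  shows "(\<phi> ^^ l) ((\<psi> ^^ k) a) = (\<psi> ^^ k) ((\<phi> ^^ l) a)"
proof -
  have "(\<phi> ^^ l) \<circ> \<psi> = \<psi> \<circ> (\<phi> ^^ l)"
    using funpow_commute_apply[OF assms[symmetric], of l] by (simp add: fun_eq_iff)
  then show ?thesis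
    by (rule funpow_commute_apply)
qed

lemma funpow_intertwines:
  assumes "\<phi> \<circ> f = f \<circ> map \<phi>"
  shows "(\<phi> ^^ k) (f xs) = f (map (\<phi> ^^ k) xs)"
proof (induction k)
  case (Suc k)
  then show ?case
    using fun_cong[OF assms, of "map (\<phi> ^^ k) xs"] by (simp add: comp_def)
qed simp

lemma linear_iff_add_scale:
  "Vector_Spaces.linear scale scale' \<phi> \<longleftrightarrow>
     vector_space scale \<and> vector_space scale' \<and>
     (\<forall>a b. \<phi> (a + b) = \<phi> a + \<phi> b) \<and> (\<forall>c a. \<phi> (scale c a) = scale' c (\<phi> a))"
  unfolding Vector_Spaces.linear_def module_hom_axioms_def module_hom_def
    module_iff_vector_space
  by auto

lemma linear_map_zero:
  assumes "Vector_Spaces.linear scale scale' \<phi>"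
  shows "\<phi> 0 = 0"
proof -
  have "\<phi> 0 + \<phi> 0 = \<phi> 0 + 0"
    using assms by (metis linear_iff_add_scale add_0_right)
  then show ?thesis
    by (rule add_left_imp_eq)
qed

lemma linear_funpow:
  assumes "vector_space scale" and "Vector_Spaces.linear scale scale \<phi>"
  shows "Vector_Spaces.linear scale scale (\<phi> ^^ k)"
proof (induction k)
  case 0
  show ?case
    using assms(1) by (simp add: linear_iff_add_scale)
next
  case (Suc k)
  then show ?case
    using Vector_Spaces.linear_compose[OF Suc assms(2)] by (simp add: comp_def)
qed

section \<open>Multilinear maps\<close>

text \<open>
  Marking the varying slot by the two lists around it, instead of by an index, lets the slots of a
  composite be read off from a concatenation, with no arithmetic on list positions.
\<close>

lemma multilinear_map_iff_append:
  "multilinear_map scale k f \<longleftrightarrow>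
     (\<forall>us vs. k = Suc (length us + length vs) \<longrightarrow>
        Vector_Spaces.linear scale scale (\<lambda>a. f (us @ a # vs))) \<and>
     (\<forall>xs. length xs \<noteq> k \<longrightarrow> f xs = 0)"
  (is "?M \<longleftrightarrow> ?A \<and> ?Z")
proof
  assume M: ?M
  have ?A
  proof (intro allI impI)
    fix us vs :: "'b list"
    assume k: "k = Suc (length us + length vs)"
    have "Vector_Spaces.linear scale scale (\<lambda>a. f ((us @ undefined # vs)[length us := a]))"
      using M unfolding multilinear_map_def
      by (elim conjE allE[of _ "us @ undefined # vs"] allE[of _ "length us"]) (use k in simp)
    then show "Vector_Spaces.linear scale scale (\<lambda>a. f (us @ a # vs))"
      by simp
  qed
  with M show "?A \<and> ?Z"
    by (simp add: multilinear_map_def)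
next
  assume AZ: "?A \<and> ?Z"
  show ?M
    unfolding multilinear_map_def
  proof (intro conjI allI impI)
    fix xs :: "'b list" and i
    assume "length xs = k" "i < k"
    then show "Vector_Spaces.linear scale scale (\<lambda>a. f (xs[i := a]))"
      using AZ by (simp add: upd_conv_take_nth_drop)
  qed (use AZ in blast)
qed

lemma multilinear_map_linear:
  assumes "multilinear_map scale k f" and "k = Suc (length us + length vs)"
  shows "Vector_Spaces.linear scale scale (\<lambda>a. f (us @ a # vs))"
  using assms by (simp add: multilinear_map_iff_append)

lemma multilinear_map_add:
  assumes "multilinear_map scale k f" and "k = Suc (length us + length vs)"
  shows "f (us @ (a + b) # vs) = f (us @ a # vs) + f (us @ b # vs)"
  using multilinear_map_linear[OF assms] by (simp add: linear_iff_add_scale)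

lemma multilinear_map_scale:
  assumes "multilinear_map scale k f" and "k = Suc (length us + length vs)"
  shows "f (us @ scale c a # vs) = scale c (f (us @ a # vs))"
  using multilinear_map_linear[OF assms] by (simp add: linear_iff_add_scale)

lemma multilinear_map_zero:
  assumes "multilinear_map scale k f" and "length xs \<noteq> k"
  shows "f xs = 0"
  using assms by (simp add: multilinear_map_def)

lemma cochainsD:
  assumes "f \<in> cochains scale \<alpha> \<beta> k"
  shows "multilinear_map scale k f" and "\<alpha> \<circ> f = f \<circ> map \<alpha>" and "\<beta> \<circ> f = f \<circ> map \<beta>"
  using assms by (simp_all add: cochains_def)

lemma vector_space_pointwise_scale:
  assumes "vector_space scale"
  shows "vector_space (pointwise_scale scale)"
proof -
  interpret vector_space scale by fact
  show ?thesis
    by unfold_locales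
      (simp_all add: pointwise_scale_def fun_eq_iff scale_right_distrib scale_left_distrib)
qed

lemma subspace_cochains:
  assumes "vector_space scale"
    and \<alpha>: "Vector_Spaces.linear scale scale \<alpha>" and \<beta>: "Vector_Spaces.linear scale scale \<beta>"
  shows "module.subspace (pointwise_scale scale) (cochains scale \<alpha> \<beta> k)"
proof -
  interpret vector_space scale by fact
  interpret F: vector_space "pointwise_scale scale"
    by (rule vector_space_pointwise_scale) fact
  have "\<alpha> 0 = 0" "\<beta> 0 = 0"
    using linear_map_zero[OF \<alpha>] linear_map_zero[OF \<beta>] .
  then show ?thesis
    using \<alpha> \<beta> assms(1) unfolding F.subspace_def
    by (auto simp: cochains_def multilinear_map_iff_append linear_iff_add_scale pointwise_scale_def
        fun_eq_iff algebra_simps)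
qed

section \<open>Partial compositions\<close>

lemma length_three_parts:
  assumes "length xs = a + b + c"
  obtains us ys vs where "xs = us @ ys @ vs" "length us = a" "length ys = b" "length vs = c"
proof
  show "xs = take a xs @ take b (drop a xs) @ drop (a + b) xs"
    by (metis append_take_drop_id drop_drop add.commute)
qed (use assms in simp_all)

lemma partial_comp_append:
  assumes "i = Suc (length us)" "n = length ys" "m = Suc (length us + length vs)"
  shows "partial_comp \<alpha> \<beta> m n i f g (us @ ys @ vs)
    = f (map (\<alpha> ^^ (n - 1)) us @ g ys # map (\<beta> ^^ (n - 1)) vs)"
  using assms by (simp add: partial_comp_def)

lemma partial_comp_outside:
  "length xs \<noteq> m + n - 1 \<Longrightarrow> partial_comp \<alpha> \<beta> m n i f g xs = 0"
  by (simp add: partial_comp_def)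

text \<open>
  Together with \<open>partial_comp_append\<close> this turns every statement about a partial composition on
  lists of the right length into one about concatenations.
\<close>

lemma slot_cases:
  assumes "1 \<le> i" "i \<le> m" "length xs = m + n - 1"
  obtains us ys vs where "xs = us @ ys @ vs"
    "i = Suc (length us)" "n = length ys" "m = Suc (length us + length vs)"
proof -
  from assms have "length xs = (i - 1) + n + (m - i)"
    by simp
  then obtain us ys vs where "xs = us @ ys @ vs" "length us = i - 1" "length ys = n"
    "length vs = m - i"
    by (rule length_three_parts)
  with assms that show thesis
    by simp
qed

text \<open>
  A slot to the left of \<open>g\<close> feeds into \<open>f\<close> through a power of \<open>\<alpha>\<close>, a slot of \<open>g\<close> through \<open>g\<close>, and a
  slot to the right through a power of \<open>\<beta>\<close>; each is linear, and so is \<open>f\<close> in the slot reached.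
\<close>

lemma multilinear_map_partial_comp:
  assumes vs: "vector_space scale"
    and \<alpha>: "Vector_Spaces.linear scale scale \<alpha>" and \<beta>: "Vector_Spaces.linear scale scale \<beta>"
    and i: "1 \<le> i" "i \<le> m"
    and f: "multilinear_map scale m f" and g: "multilinear_map scale n g"
  shows "multilinear_map scale (m + n - 1) (partial_comp \<alpha> \<beta> m n i f g)"
  unfolding multilinear_map_iff_append
proof (intro conjI allI impI)
  fix xs :: "'b list"
  assume "length xs \<noteq> m + n - 1"
  then show "partial_comp \<alpha> \<beta> m n i f g xs = 0"
    by (rule partial_comp_outside)
next
  fix us vs :: "'b list"
  assume len: "m + n - 1 = Suc (length us + length vs)"
  let ?A = "\<alpha> ^^ (n - 1)" and ?B = "\<beta> ^^ (n - 1)"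
  let ?lin = "Vector_Spaces.linear scale scale"
  consider "length us < i - 1" | "i - 1 \<le> length us" "length us < i - 1 + n"
    | "i - 1 + n \<le> length us"
    by linarith
  then show "?lin (\<lambda>a. partial_comp \<alpha> \<beta> m n i f g (us @ a # vs))"
  proof cases
    case 1
    then have "length vs = (i - 2 - length us) + n + (m - i)"
      using len i by simp
    then obtain p ys q where v: "vs = p @ ys @ q" "length p = i - 2 - length us" "length ys = n"
      "length q = m - i"
      by (rule length_three_parts)
    have eq: "partial_comp \<alpha> \<beta> m n i f g (us @ a # vs)
        = f (map ?A us @ ?A a # (map ?A p @ g ys # map ?B q))" for a
      using partial_comp_append[of i "us @ a # p" n ys m q \<alpha> \<beta> f g] v 1 i by simp
    have "?lin (\<lambda>a. f (map ?A us @ a # (map ?A p @ g ys # map ?B q)))"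
      using f by (rule multilinear_map_linear) (use v 1 i in simp)
    from Vector_Spaces.linear_compose[OF linear_funpow[OF vs \<alpha>] this] show ?thesis
      unfolding eq by (simp add: comp_def)
  next
    case 2
    define p q where "p = take (i - 1) us" and "q = drop (i - 1) us"
    have u: "us = p @ q" "length p = i - 1"
      using 2 by (simp_all add: p_def q_def)
    define r t where "r = take (n - 1 - length q) vs" and "t = drop (n - 1 - length q) vs"
    have v: "vs = r @ t" "n = Suc (length q + length r)" "length t = m - i"
      using 2 len i u by (simp_all add: r_def t_def)
    have eq: "partial_comp \<alpha> \<beta> m n i f g (us @ a # vs)
        = f (map ?A p @ g (q @ a # r) # map ?B t)" for a
      using partial_comp_append[of i p n "q @ a # r" m t \<alpha> \<beta> f g] u v i by simp
    have "?lin (\<lambda>a. f (map ?A p @ a # map ?B t))"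
      using f by (rule multilinear_map_linear) (use u v i in simp)
    from Vector_Spaces.linear_compose[OF multilinear_map_linear[OF g v(2)] this] show ?thesis
      unfolding eq by (simp add: comp_def)
  next
    case 3
    then have "length us = (i - 1) + n + (length us - (i - 1 + n))"
      by simp
    then obtain p ys q where u: "us = p @ ys @ q" "length p = i - 1" "length ys = n"
      "length q = length us - (i - 1 + n)"
      by (rule length_three_parts)
    have m: "m = Suc (length p + length (q @ a # vs))" for a
      using u len i 3 by simp
    have eq: "partial_comp \<alpha> \<beta> m n i f g (us @ a # vs)
        = f ((map ?A p @ g ys # map ?B q) @ ?B a # map ?B vs)" for a
      using partial_comp_append[of i p n ys m "q @ a # vs" \<alpha> \<beta> f g] u(1-3) m[of a] i by simp
    have "?lin (\<lambda>a. f ((map ?A p @ g ys # map ?B q) @ a # map ?B vs))"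
      using f by (rule multilinear_map_linear) (use m in simp)
    from Vector_Spaces.linear_compose[OF linear_funpow[OF vs \<beta>] this] show ?thesis
      unfolding eq by (simp add: comp_def)
  qed
qed

text \<open>
  Pulling \<open>\<phi>\<close> inside first \<open>f\<close> and then \<open>g\<close> leaves it to pass the powers of \<open>\<alpha>\<close> and \<open>\<beta>\<close>. The
  closure of cochains needs this for \<open>\<phi> = \<alpha>\<close> and for \<open>\<phi> = \<beta>\<close>. The condition \<open>\<phi> 0 = 0\<close> takes care
  of the lists of wrong length.
\<close>

lemma partial_comp_intertwines:
  assumes i: "1 \<le> i" "i \<le> m"
    and "\<phi> 0 = 0" "\<phi> \<circ> \<alpha> = \<alpha> \<circ> \<phi>" "\<phi> \<circ> \<beta> = \<beta> \<circ> \<phi>"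
    and f: "\<phi> \<circ> f = f \<circ> map \<phi>" and g: "\<phi> \<circ> g = g \<circ> map \<phi>"
  shows "\<phi> \<circ> partial_comp \<alpha> \<beta> m n i f g = partial_comp \<alpha> \<beta> m n i f g \<circ> map \<phi>"
proof
  fix xs
  show "(\<phi> \<circ> partial_comp \<alpha> \<beta> m n i f g) xs = (partial_comp \<alpha> \<beta> m n i f g \<circ> map \<phi>) xs"
  proof (cases "length xs = m + n - 1")
    case True
    with i obtain us ys vs where xs: "xs = us @ ys @ vs"
      "i = Suc (length us)" "n = length ys" "m = Suc (length us + length vs)"
      by (rule slot_cases)
    have "\<phi> (f zs) = f (map \<phi> zs)" "\<phi> (g zs) = g (map \<phi> zs)" for zs
      using fun_cong[OF f, of zs] fun_cong[OF g, of zs] by simp_all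
    then show ?thesis
      using partial_comp_append[OF xs(2-), of \<alpha> \<beta> f g]
        partial_comp_append[of i "map \<phi> us" n "map \<phi> ys" m "map \<phi> vs" \<alpha> \<beta> f g] xs
      by (simp add: comp_def funpow_commute_apply[OF assms(4)] funpow_commute_apply[OF assms(5)])
  next
    case False
    then show ?thesis
      using assms(3) by (simp add: partial_comp_outside)
  qed
qed

text \<open>
  Since \<open>(n - 1) + (p - 1) = (n + p - 1) - 1\<close>, twisting past \<open>h\<close> and then past \<open>g\<close> is the same as
  twisting once past \<open>g \<circ>\<^sub>j h\<close>.
\<close>

lemma partial_comp_sequential:
  assumes p: "p \<ge> 1" and i: "1 \<le> i" "i \<le> m" and j: "1 \<le> j" "j \<le> n"
  shows "partial_comp \<alpha> \<beta> (m + n - 1) p (i + j - 1) (partial_comp \<alpha> \<beta> m n i f g) h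
       = partial_comp \<alpha> \<beta> m (n + p - 1) i f (partial_comp \<alpha> \<beta> n p j g h)"
  (is "?L = ?R")
proof
  fix xs
  show "?L xs = ?R xs"
  proof (cases "length xs = m + (n + p - 1) - 1")
    case True
    with i obtain us ys vs where xs: "xs = us @ ys @ vs"
      "i = Suc (length us)" "n + p - 1 = length ys" "m = Suc (length us + length vs)"
      by (rule slot_cases)
    from j xs(3)[symmetric] obtain as hs bs where ys: "ys = as @ hs @ bs"
      "j = Suc (length as)" "p = length hs" "n = Suc (length as + length bs)"
      by (rule slot_cases)
    \<comment> \<open>the value of \<open>g \<circ>\<^sub>j h\<close> on \<open>ys\<close>\<close>
    let ?g = "g (map (\<alpha> ^^ (p - 1)) as @ h hs # map (\<beta> ^^ (p - 1)) bs)"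
    have e: "n + p - 1 - 1 = (n - 1) + (p - 1)"
      using p ys by simp
    have "?R xs = f (map (\<alpha> ^^ (n + p - 1 - 1)) us @ ?g # map (\<beta> ^^ (n + p - 1 - 1)) vs)"
      using partial_comp_append[OF xs(2-)] partial_comp_append[OF ys(2-)] xs(1) ys(1) by simp
    also have "\<dots> = f (map (\<alpha> ^^ (n - 1)) (map (\<alpha> ^^ (p - 1)) us) @ ?g
        # map (\<beta> ^^ (n - 1)) (map (\<beta> ^^ (p - 1)) vs))"
      unfolding e by (simp add: funpow_add)
    also have "\<dots> = partial_comp \<alpha> \<beta> m n i f g
        (map (\<alpha> ^^ (p - 1)) us @ (map (\<alpha> ^^ (p - 1)) as @ h hs # map (\<beta> ^^ (p - 1)) bs)
          @ map (\<beta> ^^ (p - 1)) vs)"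
      by (rule partial_comp_append[symmetric]) (use xs ys in simp_all)
    also have "\<dots> = ?L xs"
      using partial_comp_append[of "i + j - 1" "us @ as" p hs "m + n - 1" "bs @ vs" \<alpha> \<beta>
          "partial_comp \<alpha> \<beta> m n i f g" h] xs ys
      by simp
    finally show ?thesis ..
  next
    case False
    then show ?thesis
      using p i j by (simp add: partial_comp_outside)
  qed
qed

text \<open>
  The order of insertion decides where a twist lands: inserting \<open>h\<close> second twists the
  arguments of \<open>g\<close> by \<open>\<alpha>\<close>, and inserting it first lets \<open>\<alpha>\<close> act on the value of \<open>g\<close>. Equivariance
  of \<open>g\<close> under \<open>\<alpha>\<close> identifies the two, and that of \<open>h\<close> under \<open>\<beta>\<close> does so on the other side.
\<close>

lemma partial_comp_parallel:
  assumes n: "n \<ge> 1" and p: "p \<ge> 1" and ij: "1 \<le> i" "i < j" "j \<le> m"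
    and comm: "\<alpha> \<circ> \<beta> = \<beta> \<circ> \<alpha>"
    and g: "\<alpha> \<circ> g = g \<circ> map \<alpha>" and h: "\<beta> \<circ> h = h \<circ> map \<beta>"
  shows "partial_comp \<alpha> \<beta> (m + n - 1) p (j + n - 1) (partial_comp \<alpha> \<beta> m n i f g) h
       = partial_comp \<alpha> \<beta> (m + p - 1) n i (partial_comp \<alpha> \<beta> m p j f h) g"
  (is "?L = ?R")
proof
  fix xs
  show "?L xs = ?R xs"
  proof (cases "length xs = m + p - 1 + n - 1")
    case True
    then have "length xs = (i - 1) + n + (m + p - 1 - i)"
      using ij p by simp
    then obtain us ys ws where xs: "xs = us @ ys @ ws" "length us = i - 1" "length ys = n"
      "length ws = m + p - 1 - i"
      by (rule length_three_parts)
    then have "length ws = (j - i - 1) + p + (m - j)"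
      using ij p by simp
    then obtain cs zs vs where ws: "ws = cs @ zs @ vs" "length cs = j - i - 1" "length zs = p"
      "length vs = m - j"
      by (rule length_three_parts)
    let ?An = "\<alpha> ^^ (n - 1)" and ?Ap = "\<alpha> ^^ (p - 1)"
      and ?Bn = "\<beta> ^^ (n - 1)" and ?Bp = "\<beta> ^^ (p - 1)"
    have slot: "j + n - 1 = Suc (length (us @ ys @ cs))"
      "m + n - 1 = Suc (length (us @ ys @ cs) + length vs)"
      and slot': "i = Suc (length us)" "m + p - 1 = Suc (length us + length ws)"
      using xs ws ij p by simp_all
    have "?L xs = partial_comp \<alpha> \<beta> m n i f g
        (map ?Ap us @ map ?Ap ys @ (map ?Ap cs @ h zs # map ?Bp vs))"
      using partial_comp_append[OF slot(1) ws(3)[symmetric] slot(2), of \<alpha> \<beta>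
          "partial_comp \<alpha> \<beta> m n i f g" h] xs(1) ws(1)
      by simp
    also have "\<dots> = f (map ?An (map ?Ap us) @ g (map ?Ap ys)
        # map ?Bn (map ?Ap cs @ h zs # map ?Bp vs))"
      by (rule partial_comp_append) (use xs ws ij in simp_all)
    also have "\<dots> = f (map ?Ap (map ?An us @ g ys # map ?Bn cs)
        @ h (map ?Bn zs) # map ?Bp (map ?Bn vs))"
    proof -
      \<comment> \<open>the third equation is for the block between \<open>g\<close> and \<open>h\<close>, twisted from both sides\<close>
      have "?An (?Ap a) = ?Ap (?An a)" "?Bn (?Bp a) = ?Bp (?Bn a)" "?Bn (?Ap a) = ?Ap (?Bn a)" for a
        by (rule funpow_funpow_commute_apply, simp add: comm)+
      then have "map ?An (map ?Ap us) = map ?Ap (map ?An us)"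
        and "map ?Bn (map ?Bp vs) = map ?Bp (map ?Bn vs)"
        and "map ?Bn (map ?Ap cs) = map ?Ap (map ?Bn cs)"
        by simp_all
      moreover have "g (map ?Ap ys) = ?Ap (g ys)" and "h (map ?Bn zs) = ?Bn (h zs)"
        by (rule funpow_intertwines[symmetric], fact)+
      ultimately show ?thesis
        by (simp only: map_append list.map append.assoc append_Cons)
    qed
    also have "\<dots> = partial_comp \<alpha> \<beta> m p j f h
        ((map ?An us @ g ys # map ?Bn cs) @ map ?Bn zs @ map ?Bn vs)"
      by (rule partial_comp_append[symmetric]) (use xs ws ij in simp_all)
    also have "\<dots> = ?R xs"
      using partial_comp_append[OF slot'(1) xs(3)[symmetric] slot'(2), of \<alpha> \<beta>
          "partial_comp \<alpha> \<beta> m p j f h" g] xs(1) ws(1)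
      by simp
    finally show ?thesis .
  next
    case False
    then show ?thesis
      using n p ij by (simp add: partial_comp_outside)
  qed
qed

lemma partial_comp_eqI:
  assumes "1 \<le> i" "i \<le> m"
    and "\<And>us ys vs. \<lbrakk>i = Suc (length us); n = length ys; m = Suc (length us + length vs)\<rbrakk>
      \<Longrightarrow> f (map (\<alpha> ^^ (n - 1)) us @ g ys # map (\<beta> ^^ (n - 1)) vs) = F (us @ ys @ vs)"
    and "\<And>xs. length xs \<noteq> m + n - 1 \<Longrightarrow> F xs = 0"
  shows "partial_comp \<alpha> \<beta> m n i f g = F"
proof
  fix xs
  show "partial_comp \<alpha> \<beta> m n i f g xs = F xs"
  proof (cases "length xs = m + n - 1")
    case True
    with assms(1,2) obtain us ys vs where xs: "xs = us @ ys @ vs"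
      "i = Suc (length us)" "n = length ys" "m = Suc (length us + length vs)"
      by (rule slot_cases)
    show ?thesis
      unfolding xs(1) partial_comp_append[OF xs(2-)] by (rule assms(3)[OF xs(2-)])
  next
    case False
    then show ?thesis
      by (simp add: partial_comp_outside assms(4))
  qed
qed

lemma partial_comp_identity_right:
  assumes "1 \<le> i" "i \<le> m" and "multilinear_map scale m f"
  shows "partial_comp \<alpha> \<beta> m 1 i f identity_cochain = f"
  using assms(1,2)
proof (rule partial_comp_eqI)
  fix us ys vs :: "'b list"
  assume "1 = length ys"
  then obtain y where "ys = [y]"
    by (metis One_nat_def length_0_conv length_Suc_conv)
  then show "f (map (\<alpha> ^^ (1 - 1)) us @ identity_cochain ys # map (\<beta> ^^ (1 - 1)) vs)
      = f (us @ ys @ vs)"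
    by (simp add: identity_cochain_def)
qed (use assms(3) in \<open>simp add: multilinear_map_zero\<close>)

lemma partial_comp_identity_left:
  assumes "multilinear_map scale m f"
  shows "partial_comp \<alpha> \<beta> 1 m 1 identity_cochain f = f"
  by (rule partial_comp_eqI) (use assms in \<open>auto simp: identity_cochain_def multilinear_map_zero\<close>)

lemma identity_cochain_in_cochains:
  assumes "vector_space scale"
    and \<alpha>: "Vector_Spaces.linear scale scale \<alpha>" and \<beta>: "Vector_Spaces.linear scale scale \<beta>"
  shows "identity_cochain \<in> cochains scale \<alpha> \<beta> 1"
proof -
  have "\<alpha> 0 = 0" "\<beta> 0 = 0"
    using linear_map_zero[OF \<alpha>] linear_map_zero[OF \<beta>] .
  then show ?thesis
    using assms(1)
    by (auto simp: cochains_def multilinear_map_iff_append identity_cochain_def linear_iff_add_scale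
        fun_eq_iff hd_map length_Suc_conv)
qed

section \<open>The operad of cochains\<close>

theorem proposition4p1:
  fixes scale :: "'k::field_char_0 \<Rightarrow> 'a::ab_group_add \<Rightarrow> 'a"
    and \<alpha> \<beta> :: "'a \<Rightarrow> 'a"
  assumes "vector_space scale"
    and "Vector_Spaces.linear scale scale \<alpha>"
    and "Vector_Spaces.linear scale scale \<beta>"
    and "\<alpha> \<circ> \<beta> = \<beta> \<circ> \<alpha>"
  shows "ns_operad (pointwise_scale scale) (cochains scale \<alpha> \<beta>)
           (partial_comp \<alpha> \<beta>) identity_cochain"
proof -
  interpret F: vector_space "pointwise_scale scale"
    by (rule vector_space_pointwise_scale) fact
  have zero: "\<alpha> 0 = 0" "\<beta> 0 = 0"
    using assms(2,3) by (simp_all only: linear_map_zero)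
  have scale_zero: "scale c 0 = 0" for c
    using assms(1) by (intro module.scale_zero_right) (simp add: module_iff_vector_space)
  show ?thesis
  proof unfold_locales
    fix m n i :: nat and f g
    assume i: "1 \<le> i" "i \<le> m" and f: "f \<in> cochains scale \<alpha> \<beta> m"
      and g: "g \<in> cochains scale \<alpha> \<beta> n"
    note f' = cochainsD[OF f] and g' = cochainsD[OF g]
    show "partial_comp \<alpha> \<beta> m n i f g \<in> cochains scale \<alpha> \<beta> (m + n - 1)"
      using multilinear_map_partial_comp[OF assms(1-3) i f'(1) g'(1)]
        partial_comp_intertwines[OF i zero(1) refl assms(4) f'(2) g'(2)]
        partial_comp_intertwines[OF i zero(2) assms(4)[symmetric] refl f'(3) g'(3)]
      by (simp add: cochains_def)
    show "partial_comp \<alpha> \<beta> m n i (pointwise_scale scale c f) g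
        = pointwise_scale scale c (partial_comp \<alpha> \<beta> m n i f g)" for c
      by (auto simp: partial_comp_def pointwise_scale_def scale_zero)
    show "partial_comp \<alpha> \<beta> m n i f (pointwise_scale scale c g)
        = pointwise_scale scale c (partial_comp \<alpha> \<beta> m n i f g)" for c
      using i
      by (rule partial_comp_eqI)
        (simp_all add: partial_comp_append partial_comp_outside pointwise_scale_def scale_zero
          multilinear_map_scale[OF f'(1)])
    show "partial_comp \<alpha> \<beta> m n i (f + f2) g
        = partial_comp \<alpha> \<beta> m n i f g + partial_comp \<alpha> \<beta> m n i f2 g" for f2
      by (auto simp: partial_comp_def)
    show "partial_comp \<alpha> \<beta> m n i f (g + g2)
        = partial_comp \<alpha> \<beta> m n i f g + partial_comp \<alpha> \<beta> m n i f g2" for g2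
      using i
      by (rule partial_comp_eqI)
        (simp_all add: partial_comp_append partial_comp_outside multilinear_map_add[OF f'(1)])
    show "partial_comp \<alpha> \<beta> (m + n - 1) p (i + j - 1) (partial_comp \<alpha> \<beta> m n i f g) h
        = partial_comp \<alpha> \<beta> m (n + p - 1) i f (partial_comp \<alpha> \<beta> n p j g h)"
      if "p \<ge> 1" "1 \<le> j" "j \<le> n" for p j h
      using that i by (intro partial_comp_sequential)
  next
    show "F.subspace (cochains scale \<alpha> \<beta> k)" for k
      using assms(1-3) by (rule subspace_cochains)
    show "identity_cochain \<in> cochains scale \<alpha> \<beta> 1"
      using assms(1-3) by (rule identity_cochain_in_cochains)
  next
    fix m n p i j :: nat and f g h
    assume "n \<ge> 1" "p \<ge> 1" "1 \<le> i" "i < j" "j \<le> m"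
      and g: "g \<in> cochains scale \<alpha> \<beta> n" and h: "h \<in> cochains scale \<alpha> \<beta> p"
    then show "partial_comp \<alpha> \<beta> (m + n - 1) p (j + n - 1) (partial_comp \<alpha> \<beta> m n i f g) h
        = partial_comp \<alpha> \<beta> (m + p - 1) n i (partial_comp \<alpha> \<beta> m p j f h) g"
      using assms(4) cochainsD(2)[OF g] cochainsD(3)[OF h] by (intro partial_comp_parallel)
  next
    fix m i :: nat and f
    assume "f \<in> cochains scale \<alpha> \<beta> m"
    note f = cochainsD(1)[OF this]
    show "partial_comp \<alpha> \<beta> m 1 i f identity_cochain = f" if "1 \<le> i" "i \<le> m"
      using that f by (rule partial_comp_identity_right)
    show "partial_comp \<alpha> \<beta> 1 m 1 identity_cochain f = f"
      using f by (rule partial_comp_identity_left)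
  qed
qed

end
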